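(* Let $G$ be a bridge triangle free 2SUIG. Then $\omega(G)\le\chi(G)\le\omega(G)+1$.
   Context: Fix a constant $\epsilon\in(0,1)$. The lower stab line is $y=1$ and the upper stab line is $y=2+\epsilon$. A 2-stab interval graph (2SIG) is a graph that is the intersection graph of a family of axis-parallel rectangles, each of height $1$, each intersecting one of the two stab lines. A 2SUIG is a 2SIG having a representation (a 2SUIG representation) in which every rectangle is a unit square. In a representation, $V_1$ (lower partition) is the set of vertices whose squares meet $y=1$ and $V_2$ (upper partition) those meeting $y=2+\epsilon$; bridge edges are edges between $V_1$ and $V_2$. A bridge triangle is a triangle (induced $K_3$) exactly two of whose edges are bridge edges. A bridge triangle free 2SUIG is a graph having at least one 2SUIG representation with no bridge triangle. $\chi$ denotes chromatic number and $\omega$ clique number. *)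

theory Defs
  imports "HOL-Analysis.Analysis"
begin

section \<open>Finite simple graphs, clique number and chromatic number\<close>

definition simple_graph :: "'a set \<Rightarrow> 'a set set \<Rightarrow> bool" where
  "simple_graph V E \<longleftrightarrow> finite V \<and> (\<forall>e\<in>E. e \<subseteq> V \<and> card e = 2)"

definition clique :: "'a set \<Rightarrow> 'a set set \<Rightarrow> 'a set \<Rightarrow> bool" where
  "clique V E K \<longleftrightarrow> K \<subseteq> V \<and> (\<forall>u\<in>K. \<forall>v\<in>K. u \<noteq> v \<longrightarrow> {u, v} \<in> E)"

definition clique_number :: "'a set \<Rightarrow> 'a set set \<Rightarrow> nat" where
  "clique_number V E = Max {card K | K. clique V E K}"

definition proper_coloring :: "'a set \<Rightarrow> 'a set set \<Rightarrow> nat \<Rightarrow> ('a \<Rightarrow> nat) \<Rightarrow> bool" where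
  "proper_coloring V E k c \<longleftrightarrow>
     (\<forall>v\<in>V. c v < k) \<and> (\<forall>u\<in>V. \<forall>v\<in>V. {u, v} \<in> E \<longrightarrow> c u \<noteq> c v)"

definition chromatic_number :: "'a set \<Rightarrow> 'a set set \<Rightarrow> nat" where
  "chromatic_number V E = (LEAST k. \<exists>c. proper_coloring V E k c)"

section \<open>2-stab (unit) interval graphs\<close>

definition lower_stab_line :: "(real \<times> real) set" where
  "lower_stab_line = {(x, y). y = 1}"

definition upper_stab_line :: "real \<Rightarrow> (real \<times> real) set" where
  "upper_stab_line \<epsilon> = {(x, y). y = 2 + \<epsilon>}"

text \<open>Rectangles are closed, so touching rectangles intersect.\<close>

definition height_one_rectangle :: "(real \<times> real) set \<Rightarrow> bool" where
  "height_one_rectangle S \<longleftrightarrow> (\<exists>a b c. a < b \<and> S = {a..b} \<times> {c..c + 1})"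

definition unit_square :: "(real \<times> real) set \<Rightarrow> bool" where
  "unit_square S \<longleftrightarrow> (\<exists>a c. S = {a..a + 1} \<times> {c..c + 1})"

text \<open>
  A representation assigns a rectangle to every vertex; distinct vertices may receive the same
  rectangle. The stab lines are more than 1 apart when \<open>\<epsilon> > 0\<close>, so a rectangle of height 1
  meets at most one of them, and the disjunction below is then exclusive.
\<close>

definition two_SIG_rep ::
    "real \<Rightarrow> 'a set \<Rightarrow> 'a set set \<Rightarrow> ('a \<Rightarrow> (real \<times> real) set) \<Rightarrow> bool" where
  "two_SIG_rep \<epsilon> V E R \<longleftrightarrow>
     (\<forall>v\<in>V. height_one_rectangle (R v) \<and>
        (R v \<inter> lower_stab_line \<noteq> {} \<or> R v \<inter> upper_stab_line \<epsilon> \<noteq> {})) \<and>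
     (\<forall>u\<in>V. \<forall>v\<in>V. u \<noteq> v \<longrightarrow> ({u, v} \<in> E \<longleftrightarrow> R u \<inter> R v \<noteq> {}))"

definition two_SUIG_rep ::
    "real \<Rightarrow> 'a set \<Rightarrow> 'a set set \<Rightarrow> ('a \<Rightarrow> (real \<times> real) set) \<Rightarrow> bool" where
  "two_SUIG_rep \<epsilon> V E R \<longleftrightarrow> two_SIG_rep \<epsilon> V E R \<and> (\<forall>v\<in>V. unit_square (R v))"

definition lower_partition :: "'a set \<Rightarrow> ('a \<Rightarrow> (real \<times> real) set) \<Rightarrow> 'a set" where
  "lower_partition V R = {v \<in> V. R v \<inter> lower_stab_line \<noteq> {}}"

definition upper_partition :: "real \<Rightarrow> 'a set \<Rightarrow> ('a \<Rightarrow> (real \<times> real) set) \<Rightarrow> 'a set" where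
  "upper_partition \<epsilon> V R = {v \<in> V. R v \<inter> upper_stab_line \<epsilon> \<noteq> {}}"

definition bridge_edges ::
    "real \<Rightarrow> 'a set \<Rightarrow> 'a set set \<Rightarrow> ('a \<Rightarrow> (real \<times> real) set) \<Rightarrow> 'a set set" where
  "bridge_edges \<epsilon> V E R =
     {e \<in> E. \<exists>u\<in>lower_partition V R. \<exists>v\<in>upper_partition \<epsilon> V R. e = {u, v}}"

definition bridge_triangle ::
    "real \<Rightarrow> 'a set \<Rightarrow> 'a set set \<Rightarrow> ('a \<Rightarrow> (real \<times> real) set) \<Rightarrow> 'a set \<Rightarrow> bool" where
  "bridge_triangle \<epsilon> V E R T \<longleftrightarrow>
     clique V E T \<and> card T = 3 \<and> card {e \<in> bridge_edges \<epsilon> V E R. e \<subseteq> T} = 2"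

definition bridge_triangle_free_two_SUIG :: "real \<Rightarrow> 'a set \<Rightarrow> 'a set set \<Rightarrow> bool" where
  "bridge_triangle_free_two_SUIG \<epsilon> V E \<longleftrightarrow> simple_graph V E \<and>
     (\<exists>R. two_SUIG_rep \<epsilon> V E R \<and> \<not> (\<exists>T. bridge_triangle \<epsilon> V E R T))"

end

(*
  Order the vertices by the left ends of their squares. The squares on the stab line of v that
  start no later than v and meet it pairwise intersect, so together with v they form a clique and
  there are at most \<omega> - 1 of them. Two squares on the other stab line that start no later than v
  and meet it would also intersect each other, giving a bridge triangle; so there is at most one.
  Hence greedy colouring from left to right needs at most \<omega> + 1 colours.
*)
theory Submission
  imports Defs
begin

text \<open>\<open>Max\<close> is only informative on a finite nonempty set; this supplies the
  finiteness wherever \<open>clique_number\<close> is unfolded.\<close>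

lemma finite_clique_cards:
  assumes "finite V"
  shows "finite {card K | K. clique V E K}"
proof -
  have "{card K | K. clique V E K} \<subseteq> card ` Pow V"
    by (auto simp: clique_def)
  then show ?thesis
    using assms finite_subset by blast
qed

lemma card_le_clique_number:
  assumes "finite V" and "clique V E K"
  shows "card K \<le> clique_number V E"
  unfolding clique_number_def
  using finite_clique_cards[OF assms(1)] assms(2) by (intro Max_ge) auto

lemma card_clique_le_colors:
  assumes "proper_coloring V E k c" and "clique V E K"
  shows "card K \<le> k"
proof -
  have "inj_on c K"
    using assms unfolding inj_on_def proper_coloring_def clique_def by (meson subsetD)
  moreover have "c ` K \<subseteq> {..<k}"
    using assms by (auto simp: proper_coloring_def clique_def)
  ultimately show ?thesis
    using card_inj_on_le[of c K "{..<k}"] by simp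
qed

lemma clique_number_le_colors:
  assumes "finite V" and "proper_coloring V E k c"
  shows "clique_number V E \<le> k"
proof -
  \<comment> \<open>The empty clique makes the set under \<open>Max\<close> nonempty, even when
    \<open>V\<close> is empty.\<close>
  have "clique V E {}"
    by (simp add: clique_def)
  then show ?thesis
    unfolding clique_number_def
    using finite_clique_cards[OF assms(1)] card_clique_le_colors[OF assms(2)]
    by (subst Max_le_iff) auto
qed

text \<open>Vertices are coloured in increasing order of \<open>f\<close>, so a new vertex only has
  to avoid the at most \<open>k\<close> colours of its earlier neighbours. Ties in \<open>f\<close>
  are harmless: the non-strict comparison counts tied neighbours for both vertices, whichever is
  coloured first.\<close>

lemma greedy_coloring:
  fixes f :: "'a \<Rightarrow> 'b :: linorder"
  assumes "finite V" and "\<And>v. {v} \<notin> E"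
    and "\<And>v. v \<in> V \<Longrightarrow> card {u \<in> V. {u, v} \<in> E \<and> f u \<le> f v} \<le> k"
  shows "\<exists>c. proper_coloring V E (k + 1) c"
  using assms(1,3)
proof (induction V rule: finite_ranking_induct[where f = f])
  case empty
  then show ?case
    by (simp add: proper_coloring_def)
next
  case (insert x S)
  show ?case
  \<comment> \<open>The ranking induction does not guarantee that the inserted element is
    new.\<close>
  proof (cases "x \<in> S")
    case True
    then have "insert x S = S"
      by auto
    then show ?thesis
      using insert.IH insert.prems by simp
  next
    case False
    have "card {u \<in> S. {u, v} \<in> E \<and> f u \<le> f v} \<le> k" if "v \<in> S" for v
    proof -
      have "card {u \<in> S. {u, v} \<in> E \<and> f u \<le> f v} \<le>
          card {u \<in> insert x S. {u, v} \<in> E \<and> f u \<le> f v}"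
        using insert.hyps(1) by (intro card_mono) auto
      also have "\<dots> \<le> k"
        using insert.prems that by simp
      finally show ?thesis .
    qed
    then obtain c where c: "proper_coloring S E (k + 1) c"
      using insert.IH by blast
    define N where "N = {u \<in> S. {u, x} \<in> E}"
    \<comment> \<open>As \<open>x\<close> is inserted last, \<open>f x\<close> is maximal, so every
      neighbour in \<open>S\<close> is counted by the hypothesis for \<open>x\<close>.\<close>
    have "card N \<le> card {u \<in> insert x S. {u, x} \<in> E \<and> f u \<le> f x}"
      using insert.hyps unfolding N_def by (intro card_mono) auto
    also have "\<dots> \<le> k"
      using insert.prems by simp
    finally have "card (c ` N) \<le> k"
      using insert.hyps(1) card_image_le[of N c] by (simp add: N_def)
    then have "\<not> {..<k + 1} \<subseteq> c ` N"
      using card_mono[of "c ` N" "{..<k + 1}"] insert.hyps(1) by (auto simp: N_def)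
    then obtain i where i: "i < k + 1" "i \<notin> c ` N"
      by auto
    have "proper_coloring (insert x S) E (k + 1) (c(x := i))"
      unfolding proper_coloring_def
    proof (intro conjI ballI impI)
      fix v assume "v \<in> insert x S"
      then show "(c(x := i)) v < k + 1"
        using c i by (auto simp: proper_coloring_def)
    next
      fix u v assume uv: "u \<in> insert x S" "v \<in> insert x S" "{u, v} \<in> E"
      then have "u \<noteq> v"
        using assms(2)[of u] by auto
      moreover have "c u \<noteq> c v" if "u \<in> S" "v \<in> S"
        using that uv c by (auto simp: proper_coloring_def)
      moreover have "c w \<noteq> i" if "w \<in> S" "{w, x} \<in> E \<or> {x, w} \<in> E" for w
        using that i by (auto simp: N_def insert_commute)
      ultimately show "(c(x := i)) u \<noteq> (c(x := i)) v"
        using uv by (auto split: if_splits)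
    qed
    then show ?thesis
      by blast
  qed
qed

text \<open>Here \<open>u\<close> is the vertex alone on its line, which may be either line. As the
  two partitions are complementary, an edge is a bridge exactly when its ends lie in different ones;
  this excludes \<open>{v, w}\<close> and leaves exactly two bridges.\<close>

lemma bridge_triangleI:
  assumes tri: "{u, v} \<in> E" "{u, w} \<in> E" "{v, w} \<in> E"
    and distinct: "u \<noteq> v" "u \<noteq> w" "v \<noteq> w"
    and V: "u \<in> V" "v \<in> V" "w \<in> V"
    and upper: "\<And>x. x \<in> V \<Longrightarrow> x \<in> upper_partition \<epsilon> V R \<longleftrightarrow> x \<notin> lower_partition V R"
    and uv: "u \<in> lower_partition V R \<longleftrightarrow> v \<notin> lower_partition V R"
    and vw: "v \<in> lower_partition V R \<longleftrightarrow> w \<in> lower_partition V R"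
  shows "bridge_triangle \<epsilon> V E R {u, v, w}"
proof -
  let ?B = "bridge_edges \<epsilon> V E R" and ?L = "lower_partition V R"
  have B: "{x, y} \<in> ?B \<longleftrightarrow> {x, y} \<in> E \<and> (x \<in> ?L \<longleftrightarrow> y \<notin> ?L)" if "x \<in> V" "y \<in> V" for x y
    using upper that unfolding bridge_edges_def by (auto simp: doubleton_eq_iff)
  have "{e \<in> ?B. e \<subseteq> {u, v, w}} = {{u, v}, {u, w}}" (is "?T = _")
  proof
    show "?T \<subseteq> {{u, v}, {u, w}}"
    proof
      fix e assume e: "e \<in> ?T"
      then obtain x y where xy: "e = {x, y}" "x \<in> ?L" "y \<in> upper_partition \<epsilon> V R"
        by (auto simp: bridge_edges_def)
      then have "y \<in> V"
        by (auto simp: upper_partition_def)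
      then have "y \<notin> ?L"
        using upper xy by blast
      moreover have "x \<in> {u, v, w}" "y \<in> {u, v, w}"
        using e xy by auto
      ultimately show "e \<in> {{u, v}, {u, w}}"
        using xy uv vw by (auto simp: insert_commute)
    qed
    show "{{u, v}, {u, w}} \<subseteq> ?T"
      using B tri V uv vw by auto
  qed
  moreover have "{u, v} \<noteq> {u, w}"
    using distinct by (auto simp: doubleton_eq_iff)
  ultimately have "card ?T = 2"
    by simp
  moreover have "clique V E {u, v, w}"
    using tri V by (auto simp: clique_def insert_commute)
  ultimately show ?thesis
    using distinct by (simp add: bridge_triangle_def)
qed

text \<open>This is where the geometry enters; the result has the form that
  \<open>greedy_coloring\<close> takes as hypothesis.\<close>

lemma greedy_bound_bridge_triangle_free:
  assumes "0 < \<epsilon>" and sg: "simple_graph V E" and rep: "two_SUIG_rep \<epsilon> V E R"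
    and free: "\<nexists>T. bridge_triangle \<epsilon> V E R T"
  shows "\<exists>f :: 'a \<Rightarrow> real. \<forall>v\<in>V.
    card {u \<in> V. {u, v} \<in> E \<and> f u \<le> f v} \<le> clique_number V E"
proof -
  let ?L = "lower_partition V R"
  have "\<forall>v\<in>V. \<exists>a c. R v = {a..a + 1} \<times> {c..c + 1}"
    using rep by (simp add: two_SUIG_rep_def unit_square_def)
  \<comment> \<open>The point \<open>(f v, g v)\<close> is the lower left corner of the square of
    \<open>v\<close>; \<open>f\<close> is the ordering sought.\<close>
  then obtain f g where R: "\<And>v. v \<in> V \<Longrightarrow> R v = {f v..f v + 1} \<times> {g v..g v + 1}"
    by metis
  have stab: "R v \<inter> {(x, y). y = t} \<noteq> {} \<longleftrightarrow> g v \<le> t \<and> t \<le> g v + 1" if "v \<in> V" for v t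
  proof -
    have "{(x :: real, y). y = t} = UNIV \<times> {t}"
      by auto
    then show ?thesis
      using R[OF that] by (simp add: Times_Int_Times)
  qed
  have lower: "v \<in> ?L \<longleftrightarrow> 0 \<le> g v \<and> g v \<le> 1" if "v \<in> V" for v
    using that by (auto simp: stab lower_partition_def lower_stab_line_def)
  have upper: "v \<in> upper_partition \<epsilon> V R \<longleftrightarrow> 1 + \<epsilon> \<le> g v \<and> g v \<le> 2 + \<epsilon>" if "v \<in> V" for v
    using that by (auto simp: stab upper_partition_def upper_stab_line_def)
  have "v \<in> ?L \<or> v \<in> upper_partition \<epsilon> V R" if "v \<in> V" for v
    using that rep
    by (auto simp: two_SUIG_rep_def two_SIG_rep_def lower_partition_def upper_partition_def)
  \<comment> \<open>Since \<epsilon> is positive, the ranges of \<open>g\<close> for the two lines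
    are disjoint.\<close>
  then have upper_iff: "v \<in> upper_partition \<epsilon> V R \<longleftrightarrow> v \<notin> ?L" if "v \<in> V" for v
    using that lower[OF that] upper[OF that] \<open>0 < \<epsilon>\<close> by force
  have meet: "R u \<inter> R v \<noteq> {} \<longleftrightarrow> \<bar>f u - f v\<bar> \<le> 1 \<and> \<bar>g u - g v\<bar> \<le> 1" if "u \<in> V" "v \<in> V" for u v
    using R[OF that(1)] R[OF that(2)] by (auto simp: Times_Int_Times)
  have edge: "{u, v} \<in> E \<longleftrightarrow> \<bar>f u - f v\<bar> \<le> 1 \<and> \<bar>g u - g v\<bar> \<le> 1"
    if "u \<in> V" "v \<in> V" "u \<noteq> v" for u v
    using rep that meet[OF that(1,2)] by (simp add: two_SUIG_rep_def two_SIG_rep_def)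
  \<comment> \<open>The bottoms of squares on one stab line lie in an interval of length 1, so their
    vertical extents always meet and only the horizontal distance decides adjacency.\<close>
  have same_line: "{u, v} \<in> E"
    if "u \<in> V" "v \<in> V" "u \<noteq> v" "u \<in> ?L \<longleftrightarrow> v \<in> ?L" "\<bar>f u - f v\<bar> \<le> 1" for u v
  proof -
    have "\<bar>g u - g v\<bar> \<le> 1"
      using that(4) lower[OF that(1)] lower[OF that(2)] upper[OF that(1)] upper[OF that(2)]
        upper_iff[OF that(1)] upper_iff[OF that(2)]
      by (cases "v \<in> ?L") auto
    then show ?thesis
      using edge that by blast
  qed
  have fin: "finite V"
    using sg by (simp add: simple_graph_def)
  have no_loop: "{v} \<notin> E" for v
    using sg by (auto simp: simple_graph_def)
  have "card {u \<in> V. {u, v} \<in> E \<and> f u \<le> f v} \<le> clique_number V E" if v: "v \<in> V" for v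
  proof -
    define N where "N = {u \<in> V. {u, v} \<in> E \<and> f u \<le> f v}"
    define A where "A = {u \<in> N. u \<in> ?L \<longleftrightarrow> v \<in> ?L}"
    define B where "B = {u \<in> N. u \<in> ?L \<longleftrightarrow> v \<notin> ?L}"
    have N: "u \<in> V" "u \<noteq> v" "{u, v} \<in> E" "f v - 1 \<le> f u" "f u \<le> f v" if "u \<in> N" for u
    proof -
      show u: "u \<in> V" "u \<noteq> v" "{u, v} \<in> E" "f u \<le> f v"
        using that no_loop[of v] by (auto simp: N_def)
      show "f v - 1 \<le> f u"
        using edge[OF u(1) v u(2)] u(3) by auto
    qed
    have "finite N"
      using fin by (simp add: N_def)
    \<comment> \<open>All left ends in \<open>N\<close> lie in the window from
      \<open>f v - 1\<close> to \<open>f v\<close>, hence are pairwise at distance at most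
      1.\<close>
    have adj: "{u, w} \<in> E" if "u \<in> N" "w \<in> N" "u \<noteq> w" "u \<in> ?L \<longleftrightarrow> w \<in> ?L" for u w
      using N[OF that(1)] N[OF that(2)] that by (intro same_line) auto
    have "clique V E (insert v A)"
      unfolding clique_def
    proof (intro conjI ballI impI)
      show "insert v A \<subseteq> V"
        using v N by (auto simp: A_def)
      fix u w assume "u \<in> insert v A" "w \<in> insert v A" "u \<noteq> w"
      then show "{u, w} \<in> E"
        using adj[of u w] N(3)[of u] N(3)[of w] by (auto simp: A_def insert_commute)
    qed
    then have "card (insert v A) \<le> clique_number V E"
      using card_le_clique_number fin by blast
    \<comment> \<open>Counting \<open>v\<close> itself in the clique leaves room for the one
      possible element of \<open>B\<close>, so the total stays within the clique number.\<close>
    moreover have "card (insert v A) = Suc (card A)"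
      using \<open>finite N\<close> N(2) by (subst card_insert_disjoint) (auto simp: A_def)
    moreover have "card B \<le> 1"
    proof -
      have "u = w" if "u \<in> B" "w \<in> B" for u w
      proof (rule ccontr)
        assume "u \<noteq> w"
        have uw: "u \<in> N" "w \<in> N" "u \<in> ?L \<longleftrightarrow> v \<notin> ?L" "u \<in> ?L \<longleftrightarrow> w \<in> ?L"
          using that by (auto simp: B_def)
        \<comment> \<open>The vertex \<open>v\<close> is the one alone on its line.\<close>
        have "bridge_triangle \<epsilon> V E R {v, u, w}"
          using N[OF uw(1)] N[OF uw(2)] adj[OF uw(1,2) \<open>u \<noteq> w\<close> uw(4)] uw v upper_iff \<open>u \<noteq> w\<close>
          by (intro bridge_triangleI) (auto simp: insert_commute)
        then show False
          using free by blast
      qed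
      then show ?thesis
        using \<open>finite N\<close> by (auto simp: card_le_Suc0_iff_eq B_def)
    qed
    moreover have "card N \<le> card A + card B"
    proof -
      have "N = A \<union> B"
        by (auto simp: A_def B_def)
      then show ?thesis
        using card_Un_le[of A B] by simp
    qed
    ultimately show ?thesis
      by (simp add: N_def)
  qed
  then show ?thesis
    by blast
qed

theorem theorem2:
  fixes \<epsilon> :: real and V :: "'a set" and E :: "'a set set"
  assumes "0 < \<epsilon>" and "\<epsilon> < 1"
    and "bridge_triangle_free_two_SUIG \<epsilon> V E"
  shows "clique_number V E \<le> chromatic_number V E \<and>
         chromatic_number V E \<le> clique_number V E + 1"
proof -
  obtain R where sg: "simple_graph V E" and rep: "two_SUIG_rep \<epsilon> V E R"
    and free: "\<nexists>T. bridge_triangle \<epsilon> V E R T"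
    using assms(3) by (auto simp: bridge_triangle_free_two_SUIG_def)
  have fin: "finite V" and no_loop: "\<And>v. {v} \<notin> E"
    using sg by (auto simp: simple_graph_def)
  obtain f :: "'a \<Rightarrow> real" where
    "\<forall>v\<in>V. card {u \<in> V. {u, v} \<in> E \<and> f u \<le> f v} \<le> clique_number V E"
    using greedy_bound_bridge_triangle_free[OF assms(1) sg rep free] by blast
  then have ex: "\<exists>c. proper_coloring V E (clique_number V E + 1) c"
    using greedy_coloring[OF fin no_loop] by blast
  \<comment> \<open>The lower bound also relies on the greedy colouring: the least number of colours
    is attained only because some colouring exists.\<close>
  then have "\<exists>c. proper_coloring V E (chromatic_number V E) c"
    unfolding chromatic_number_def by (rule LeastI)
  then have "clique_number V E \<le> chromatic_number V E"
    using clique_number_le_colors[OF fin] by blast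
  moreover have "chromatic_number V E \<le> clique_number V E + 1"
    using ex unfolding chromatic_number_def by (rule Least_le)
  ultimately show ?thesis ..
qed

end
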